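(* Let $a,b:\mathbb{N}\to\mathbb{R}$ be sequences, and put $S(x)=\sum_{n=1}^\infty\bigl(a_n\cos(nx)+b_n\sin(nx)\bigr)$ and $f(x)=\tfrac12a_0+S(x)$ for $x\in\mathbb{R}$. Assume: (1) $x\mapsto a_0S(x)$ is integrable on $[-\pi,\pi]$; (2) $x\mapsto S(x)^2$ is integrable on $[-\pi,\pi]$; (3) for every $n\ge1$, $x\mapsto a_n\cos(nx)+b_n\sin(nx)$ is integrable on $[-\pi,\pi]$; (4) $\sum_{n=1}^\infty\int_{-\pi}^{\pi}\bigl|a_n\cos(nx)+b_n\sin(nx)\bigr|\,dx<\infty$; (5) $\int_{-\pi}^{\pi}S(x)^2\,dx=\pi\sum_{n=1}^\infty(a_n^2+b_n^2)$. Then $$\frac1\pi\int_{-\pi}^{\pi}[f(x)]^2\,dx=\frac12a_0^2+\sum_{n=1}^\infty(a_n^2+b_n^2).$$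
   Context: The sequences $a,b$ are arbitrary real sequences indexed by $\mathbb{N}=\{0,1,2,\dots\}$; they are not assumed to be the Fourier coefficients of a given function. Integrability is with respect to Lebesgue measure. Infinite sums are unconditional sums of real numbers, with the convention (as in Lean's Mathlib) that a sum which does not converge unconditionally is assigned the value $0$. *)

theory Defs
  imports "HOL-Analysis.Analysis"
begin

text \<open>The sums are \<^const>\<open>infsum\<close>: unconditional sums, equal to 0 where there is no
  unconditional convergence.\<close>

definition trig_term :: "(nat \<Rightarrow> real) \<Rightarrow> (nat \<Rightarrow> real) \<Rightarrow> nat \<Rightarrow> real \<Rightarrow> real" where
  "trig_term a b n x = a n * cos (real n * x) + b n * sin (real n * x)"

definition trig_S :: "(nat \<Rightarrow> real) \<Rightarrow> (nat \<Rightarrow> real) \<Rightarrow> real \<Rightarrow> real" where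
  "trig_S a b x = (\<Sum>\<^sub>\<infinity>n\<in>{1..}. trig_term a b n x)"

definition trig_f :: "(nat \<Rightarrow> real) \<Rightarrow> (nat \<Rightarrow> real) \<Rightarrow> real \<Rightarrow> real" where
  "trig_f a b x = 1 / 2 * a 0 + trig_S a b x"

end

theory Submission
  imports Defs
begin

text \<open>
  Expanding the square gives
  \<open>f\<^sup>2 = a\<^sub>0\<^sup>2 / 4 + a\<^sub>0 S + S\<^sup>2\<close>. Over \<open>[-\<pi>, \<pi>]\<close> the constant contributes
  \<open>\<pi> a\<^sub>0\<^sup>2 / 2\<close>, the last summand is given by hypothesis, and so everything
  rests on the cross term vanishing.

  If \<open>a\<^sub>0 = 0\<close> there is nothing to show. Otherwise integrability of \<open>a\<^sub>0 S\<close> makes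
  \<open>S\<close> measurable, and the summability of the \<open>L\<^sup>1\<close> norms of the harmonics justifies
  integrating \<open>S\<close> termwise (lemma \<open>integral_infsum\<close>). Each harmonic runs through
  whole periods and integrates to \<open>0\<close> (lemma \<open>set_integral_trig_term_eq_0\<close>).
\<close>

text \<open>
  By Tonelli the sum of the norms has finite integral and hence is finite almost everywhere, so
  outside a null set the family is absolutely summable and its unconditional sum is the usual
  series, to which dominated convergence applies. On the null set
  the unconditional sum has the default value \<open>0\<close> wherever it diverges; measurability of the
  sum is assumed because \<open>M\<close> need not be complete.
\<close>

lemma integral_infsum:
  fixes f :: "nat \<Rightarrow> 'a \<Rightarrow> real"
  assumes int: "\<And>n. integrable M (f n)"
    and sum: "summable (\<lambda>n. LINT x|M. \<bar>f n x\<bar>)"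
    and meas: "(\<lambda>x. \<Sum>\<^sub>\<infinity>n. f n x) \<in> borel_measurable M"
  shows "(LINT x|M. (\<Sum>\<^sub>\<infinity>n. f n x)) = (\<Sum>n. LINT x|M. f n x)"
proof -
  have "(\<integral>\<^sup>+x. (\<Sum>n. ennreal \<bar>f n x\<bar>) \<partial>M) = (\<Sum>n. \<integral>\<^sup>+x. ennreal \<bar>f n x\<bar> \<partial>M)"
    using int by (intro nn_integral_suminf) auto
  also have "\<dots> = (\<Sum>n. ennreal (LINT x|M. \<bar>f n x\<bar>))"
    using int by (simp add: nn_integral_eq_integral)
  also have "\<dots> \<noteq> \<infinity>"
    using sum by (simp add: suminf_ennreal2)
  finally have "AE x in M. (\<Sum>n. ennreal \<bar>f n x\<bar>) \<noteq> \<infinity>"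
    using int by (intro nn_integral_PInf_AE) auto
  then have AE: "AE x in M. summable (\<lambda>n. \<bar>f n x\<bar>)"
    by eventually_elim (rule summable_suminf_not_top, auto)
  have "AE x in M. (\<Sum>\<^sub>\<infinity>n. f n x) = (\<Sum>n. f n x)"
    using AE
  proof eventually_elim
    case (elim x)
    then have "(\<lambda>n. f n x) summable_on UNIV"
      by (intro norm_summable_imp_summable_on) simp
    then show ?case
      by (metis has_sum_imp_sums has_sum_infsum sums_unique)
  qed
  then have "(LINT x|M. (\<Sum>\<^sub>\<infinity>n. f n x)) = (LINT x|M. (\<Sum>n. f n x))"
    using int meas by (intro integral_cong_AE) auto
  also have "\<dots> = (\<Sum>n. LINT x|M. f n x)"
    using int AE sum by (intro integral_suminf) auto
  finally show ?thesis .
qed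

lemma set_integral_trig_term_eq_0:
  assumes "n \<ge> 1"
    and "set_integrable lebesgue {-pi..pi} (trig_term a b n)"
  shows "(LINT x:{-pi..pi}|lebesgue. trig_term a b n x) = 0"
proof -
  define F where "F x = (a n * sin (real n * x) - b n * cos (real n * x)) / real n" for x
  have "(F has_vector_derivative trig_term a b n x) (at x within {-pi..pi})" for x
    unfolding F_def trig_term_def has_real_derivative_iff_has_vector_derivative [symmetric]
    using \<open>n \<ge> 1\<close> by (auto intro!: derivative_eq_intros simp: field_simps)
  then have "(trig_term a b n has_integral F pi - F (- pi)) {-pi..pi}"
    by (intro fundamental_theorem_of_calculus) auto
  moreover have "F pi = F (- pi)"
    by (simp add: F_def sin_npi)
  ultimately show ?thesis
    using set_lebesgue_integral_eq_integral(2) [OF assms(2)] by (simp add: integral_unique)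
qed

lemma set_integral_trig_S_eq_0:
  assumes "set_integrable lebesgue {-pi..pi} (trig_S a b)"
    and "\<And>n. n \<ge> 1 \<Longrightarrow> set_integrable lebesgue {-pi..pi} (trig_term a b n)"
    and "(\<lambda>n. LINT x:{-pi..pi}|lebesgue. \<bar>trig_term a b n x\<bar>) summable_on {1..}"
  shows "(LINT x:{-pi..pi}|lebesgue. trig_S a b x) = 0"
proof -
  define g where "g n x = indicator {-pi..pi} x * trig_term a b (Suc n) x" for n x
  have bij: "bij_betw Suc UNIV {1..}"
    by (rule bij_betwI [where g = "\<lambda>n. n - 1"]) auto
  have S: "indicator {-pi..pi} x * trig_S a b x = (\<Sum>\<^sub>\<infinity>n. g n x)" for x
    unfolding g_def trig_S_def infsum_cmult_right'
      infsum_reindex_bij_betw [OF bij, symmetric] by (rule refl)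
  have int: "integrable lebesgue (g n)" for n
    using assms(2) [of "Suc n"] by (simp add: set_integrable_def g_def [abs_def])
  have "(\<lambda>n. LINT x:{-pi..pi}|lebesgue. \<bar>trig_term a b (Suc n) x\<bar>) summable_on UNIV"
    using assms(3) unfolding summable_on_reindex_bij_betw [OF bij, symmetric] .
  then have "(\<lambda>n. LINT x|lebesgue. \<bar>g n x\<bar>) summable_on UNIV"
    by (simp add: set_lebesgue_integral_def g_def abs_mult)
  then have sum: "summable (\<lambda>n. LINT x|lebesgue. \<bar>g n x\<bar>)"
    by (rule summable_on_imp_summable)
  have meas: "(\<lambda>x. \<Sum>\<^sub>\<infinity>n. g n x) \<in> borel_measurable lebesgue"
    using assms(1) by (simp add: set_integrable_def flip: S)
  have "(LINT x|lebesgue. g n x) = 0" for n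
    using set_integral_trig_term_eq_0 [OF _ assms(2), of "Suc n"]
    by (simp add: set_lebesgue_integral_def g_def)
  then show ?thesis
    using integral_infsum [OF int sum meas] by (simp add: set_lebesgue_integral_def S)
qed

theorem theorem4p1:
  fixes a b :: "nat \<Rightarrow> real"
  assumes "set_integrable lebesgue {-pi..pi} (\<lambda>x. a 0 * trig_S a b x)"
    and "set_integrable lebesgue {-pi..pi} (\<lambda>x. (trig_S a b x)\<^sup>2)"
    and "\<And>n. n \<ge> 1 \<Longrightarrow> set_integrable lebesgue {-pi..pi} (\<lambda>x. trig_term a b n x)"
    and "(\<lambda>n. LINT x:{-pi..pi}|lebesgue. \<bar>trig_term a b n x\<bar>) summable_on {1..}"
    and "(LINT x:{-pi..pi}|lebesgue. (trig_S a b x)\<^sup>2)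
           = pi * (\<Sum>\<^sub>\<infinity>n\<in>{1..}. ((a n)\<^sup>2 + (b n)\<^sup>2))"
  shows "1 / pi * (LINT x:{-pi..pi}|lebesgue. (trig_f a b x)\<^sup>2)
           = 1 / 2 * (a 0)\<^sup>2 + (\<Sum>\<^sub>\<infinity>n\<in>{1..}. ((a n)\<^sup>2 + (b n)\<^sup>2))"
proof -
  have cross: "(LINT x:{-pi..pi}|lebesgue. a 0 * trig_S a b x) = 0"
  proof (cases "a 0 = 0")
    case True
    then show ?thesis by (simp add: set_lebesgue_integral_def)
  next
    case False
    then have "set_integrable lebesgue {-pi..pi} (trig_S a b)"
      using assms(1) by simp
    then show ?thesis
      using set_integral_trig_S_eq_0 assms(3,4) by simp
  qed
  have const_int: "set_integrable lebesgue {-pi..pi} (\<lambda>x. (a 0)\<^sup>2 / 4)"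
    by (simp add: set_integrable_def)
  have const: "(LINT x:{-pi..pi}|lebesgue. (a 0)\<^sup>2 / 4) = pi * (a 0)\<^sup>2 / 2"
    by (simp add: set_lebesgue_integral_def)
  have "(LINT x:{-pi..pi}|lebesgue. (trig_f a b x)\<^sup>2)
      = (LINT x:{-pi..pi}|lebesgue. ((a 0)\<^sup>2 / 4 + a 0 * trig_S a b x) + (trig_S a b x)\<^sup>2)"
    by (simp add: trig_f_def power2_eq_square algebra_simps)
  also have "\<dots> = pi * (a 0)\<^sup>2 / 2 + pi * (\<Sum>\<^sub>\<infinity>n\<in>{1..}. ((a n)\<^sup>2 + (b n)\<^sup>2))"
    unfolding set_integral_add(2) [OF set_integral_add(1) [OF const_int assms(1)] assms(2)]
      set_integral_add(2) [OF const_int assms(1)] cross const assms(5) by simp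
  finally show ?thesis
    by (simp add: field_simps)
qed

end
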